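(* Let $K\ge 2$ and let $T=(t_{ij})$ be a $K\times K$ stochastic matrix of the block form $$T=\begin{bmatrix}1 & \mathbf{0}_{1\times(K-1)}\\ r & Q\end{bmatrix},$$ where $r$ is a $(K-1)\times 1$ column vector and $Q$ is an irreducible $(K-1)\times(K-1)$ matrix. If $t_{i1}>0$ for some $i>1$ (i.e. $r$ has at least one positive entry), then the limit $T^\infty=\lim_{n\to\infty}T^n$ exists and $$T^\infty=\begin{bmatrix}1 & \mathbf{0}\\ (I-Q)^{-1}r & \mathbf{0}\end{bmatrix}$$ (in particular $I-Q$ is invertible), where $I$ is the $(K-1)\times(K-1)$ identity matrix.
   Context: A stochastic matrix is a square matrix with non-negative entries all of whose row sums equal $1$. In the DeGroot opinion model, $T$ is the trust matrix among $K$ agents: $t_{ij}$ is the trust agent $i$ puts in agent $j$, and opinions evolve by $x[n+1]=Tx[n]$. Agent $1$ is the stubborn agent, and agents $2,\dots,K$ are the ordinary agents. *)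

theory Defs
  imports "Jordan_Normal_Form.Matrix" "HOL-Combinatorics.Permutations" Complex_Main
begin

definition stochastic_mat :: "real mat \<Rightarrow> bool" where
  "stochastic_mat A \<longleftrightarrow>
     square_mat A \<and>
     (\<forall>i < dim_row A. \<forall>j < dim_col A. 0 \<le> A $$ (i, j)) \<and>
     (\<forall>i < dim_row A. (\<Sum>j < dim_col A. A $$ (i, j)) = 1)"

text \<open>The matrix with entries \<open>A $$ (p i, p j)\<close> is the conjugate of \<open>A\<close> by the permutation
  matrix of \<open>p\<close>.\<close>

definition permute_mat :: "(nat \<Rightarrow> nat) \<Rightarrow> 'a mat \<Rightarrow> 'a mat" where
  "permute_mat p A = mat (dim_row A) (dim_col A) (\<lambda>(i, j). A $$ (p i, p j))"

text \<open>A square matrix is reducible if a simultaneous permutation of its rows and columns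
  makes it block upper triangular with two nonempty square diagonal blocks. In particular
  every \<open>1 \<times> 1\<close> matrix, including the zero matrix, is irreducible.\<close>

definition reducible_mat :: "'a::zero mat \<Rightarrow> bool" where
  "reducible_mat A \<longleftrightarrow>
     square_mat A \<and>
     (\<exists>p k m B C D. p permutes {..<dim_row A} \<and> 0 < k \<and> 0 < m \<and>
        B \<in> carrier_mat k k \<and> C \<in> carrier_mat k m \<and> D \<in> carrier_mat m m \<and>
        permute_mat p A = four_block_mat B C (0\<^sub>m m k) D)"

definition irreducible_mat :: "'a::zero mat \<Rightarrow> bool" where
  "irreducible_mat A \<longleftrightarrow> square_mat A \<and> \<not> reducible_mat A"

text \<open>The type of matrices carries no topology; since the dimensions are fixed, convergence
  is entrywise. Entries outside the dimensions are unspecified and must not be constrained.\<close>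

definition mat_LIMSEQ :: "(nat \<Rightarrow> real mat) \<Rightarrow> real mat \<Rightarrow> bool" where
  "mat_LIMSEQ X L \<longleftrightarrow>
     (\<forall>n. X n \<in> carrier_mat (dim_row L) (dim_col L)) \<and>
     (\<forall>i < dim_row L. \<forall>j < dim_col L. (\<lambda>n. X n $$ (i, j)) \<longlonglongrightarrow> L $$ (i, j))"

end

theory Submission
  imports Defs "Jordan_Normal_Form.Determinant"
begin

text \<open>The row sums \<open>Q\<^sup>n 1\<close> decrease to a limit \<open>s\<close> with \<open>s = Q s\<close>. By a maximum principle such
  an \<open>s\<close> is zero: on the set where a positive maximum is attained the rows of \<open>Q\<close> sum to \<open>1\<close> and
  are supported in that set, which contradicts irreducibility since some row sum is less than
  \<open>1\<close>. Hence \<open>Q\<^sup>n \<rightarrow> 0\<close>, and the same principle shows that \<open>I - Q\<close> has trivial kernel. Finally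
  \<open>r = (I - Q) 1\<close>, so \<open>(I - Q)\<^sup>-\<^sup>1 r = 1\<close>, while the first column of \<open>T\<^sup>n\<close> has lower part
  \<open>1 - Q\<^sup>n 1\<close>.\<close>

section \<open>Powers, irreducibility and inverses of general square matrices\<close>

lemma index_mult_mat_sum:
  assumes "A \<in> carrier_mat n k" "B \<in> carrier_mat k l" "i < n" "j < l"
  shows "(A * B) $$ (i, j) = (\<Sum>x<k. A $$ (i, x) * B $$ (x, j))"
  using assms by (simp add: scalar_prod_def atLeast0LessThan)

text \<open>\<open>pow_mat\<close> appends the new factor on the right; with the factor on the left,
  the limit of the row sums becomes a fixed vector.\<close>

lemma pow_mat_Suc_left:
  assumes "A \<in> carrier_mat n n"
  shows "A ^\<^sub>m Suc k = A * A ^\<^sub>m k"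
proof (induction k)
  case 0
  show ?case using assms by simp
next
  case (Suc k)
  have "A ^\<^sub>m Suc (Suc k) = (A * A ^\<^sub>m k) * A"
    using Suc by simp
  also have "\<dots> = A * (A ^\<^sub>m k * A)"
    using assms by (intro assoc_mult_mat) auto
  finally show ?case by simp
qed

lemma pow_mat_nonneg:
  fixes A :: "'a::linordered_semidom mat"
  assumes A: "A \<in> carrier_mat n n" and nonneg: "\<And>i j. i < n \<Longrightarrow> j < n \<Longrightarrow> 0 \<le> A $$ (i, j)"
  shows "i < n \<Longrightarrow> j < n \<Longrightarrow> 0 \<le> (A ^\<^sub>m k) $$ (i, j)"
proof (induction k arbitrary: j)
  case 0
  then show ?case using A by simp
next
  case (Suc k)
  have "(A ^\<^sub>m Suc k) $$ (i, j) = (\<Sum>x<n. (A ^\<^sub>m k) $$ (i, x) * A $$ (x, j))"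
    using index_mult_mat_sum[OF pow_carrier_mat[OF A] A Suc.prems] by simp
  then show ?case
    using Suc nonneg by (auto intro!: sum_nonneg)
qed

text \<open>If no nonzero entry led from \<open>S\<close> to its complement, listing the complement
  before \<open>S\<close> would expose a zero lower left block.\<close>

lemma irreducible_mat_exists_nonzero:
  assumes irr: "irreducible_mat A" and A: "A \<in> carrier_mat n n"
    and S: "S \<subset> {..<n}" "S \<noteq> {}"
  obtains i j where "i \<in> S" "j < n" "j \<notin> S" "A $$ (i, j) \<noteq> 0"
proof -
  have False if zero: "\<And>i j. i \<in> S \<Longrightarrow> j < n \<Longrightarrow> j \<notin> S \<Longrightarrow> A $$ (i, j) = 0"
  proof -
    define m where "m = card S"
    define k where "k = n - m"
    have fin: "finite S" using S finite_subset by blast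
    have "card S < n" using psubset_card_mono[OF _ S(1)] by simp
    then have n: "n = k + m" and k: "0 < k" and m: "0 < m"
      using S fin by (auto simp: k_def m_def card_gt_0_iff)
    have "card ({..<n} - S) = k"
      using S fin by (subst card_Diff_subset) (auto simp: k_def m_def)
    then obtain f where f: "bij_betw f {..<k} ({..<n} - S)"
      using finite_same_card_bij[of "{..<k}" "{..<n} - S"] by auto
    obtain g where g: "bij_betw g {k..<n} S"
      using finite_same_card_bij[of "{k..<n}" S] fin n m_def by auto
    \<comment> \<open>The rows of \<open>S\<close> go last because \<open>reducible_mat\<close> has
      its zero block at the lower left; \<open>p\<close> is the identity from \<open>n\<close> on,
      as \<open>permutes\<close> demands.\<close>
    define p where "p x = (if x < k then f x else if x < n then g x else x)" for x
    have pf: "bij_betw p {..<k} ({..<n} - S)"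
      using f by (rule iffD1[OF bij_betw_cong, rotated]) (simp add: p_def)
    have pg: "bij_betw p {k..<n} S"
      using g by (rule iffD1[OF bij_betw_cong, rotated]) (simp add: p_def)
    have "bij_betw p ({..<k} \<union> {k..<n}) (({..<n} - S) \<union> S)"
      by (intro bij_betw_combine pf pg) auto
    moreover have "{..<k} \<union> {k..<n} = {..<n}" "({..<n} - S) \<union> S = {..<n}"
      using n S by auto
    ultimately have "bij_betw p {..<n} {..<n}" by simp
    then have perm: "p permutes {..<dim_row A}"
      using A n by (intro bij_imp_permutes) (auto simp: p_def)
    have lower: "A $$ (p i, p j) = 0" if "k \<le> i" "i < n" "j < k" for i j
      using zero bij_betwE[OF pf] bij_betwE[OF pg] that by auto
    have "permute_mat p A = four_block_mat (mat k k (\<lambda>(i, j). A $$ (p i, p j)))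
        (mat k m (\<lambda>(i, j). A $$ (p i, p (j + k)))) (0\<^sub>m m k)
        (mat m m (\<lambda>(i, j). A $$ (p (i + k), p (j + k))))"
      using A n lower by (intro eq_matI) (auto simp: permute_mat_def)
    then have "reducible_mat A"
      unfolding reducible_mat_def
      using perm k m A by (metis mat_carrier carrier_matD square_mat.simps)
    then show False using irr by (simp add: irreducible_mat_def)
  qed
  then show ?thesis using that by blast
qed

lemma inverse_mat_exists:
  fixes A :: "'a::field mat"
  assumes A: "A \<in> carrier_mat n n"
    and ker: "\<And>v. v \<in> carrier_vec n \<Longrightarrow> A *\<^sub>v v = 0\<^sub>v n \<Longrightarrow> v = 0\<^sub>v n"
  obtains B where "B \<in> carrier_mat n n" "A * B = 1\<^sub>m n" "B * A = 1\<^sub>m n"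
proof -
  have "det A \<noteq> 0"
    using ker by (auto simp: det_0_iff_vec_prod_zero_field[OF A])
  \<comment> \<open>\<open>()\<close> fills the extension slot of the ring record; being a unit of
    that ring means having a two-sided inverse.\<close>
  from det_non_zero_imp_unit[OF A this, of "()"] show ?thesis
    using that by (auto simp: Units_def ring_mat_def)
qed

section \<open>Irreducible substochastic matrices: maximum principle and decay of powers\<close>

locale irreducible_substochastic =
  fixes Q :: "real mat" and m :: nat
  assumes Q: "Q \<in> carrier_mat m m"
    and nonneg: "\<And>i j. i < m \<Longrightarrow> j < m \<Longrightarrow> 0 \<le> Q $$ (i, j)"
    and row_le: "\<And>i. i < m \<Longrightarrow> (\<Sum>j<m. Q $$ (i, j)) \<le> 1"
    and row_less: "\<exists>i<m. (\<Sum>j<m. Q $$ (i, j)) < 1"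
    and irreducible: "irreducible_mat Q"
begin

lemma maximum_principle:
  assumes w: "\<And>i. i < m \<Longrightarrow> w i \<le> (\<Sum>j<m. Q $$ (i, j) * w j)" and i: "i < m"
  shows "w i \<le> 0"
proof (rule ccontr)
  assume "\<not> w i \<le> 0"
  define M where "M = Max (w ` {..<m})"
  have le_M: "w j \<le> M" if "j < m" for j
    using that by (simp add: M_def)
  have M: "0 < M" using le_M[OF i] \<open>\<not> w i \<le> 0\<close> by simp
  define S where "S = {j. j < m \<and> w j = M}"
  have "M \<in> w ` {..<m}" unfolding M_def using i by (intro Max_in) auto
  then have "S \<noteq> {}" by (auto simp: S_def)
  \<comment> \<open>At a maximal index \<open>k\<close>, \<open>M = w k\<close> is at most the
    weighted sum, which is at most \<open>M\<close> times the row sum, hence at most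
    \<open>M\<close>. Equality holds throughout, and the nonnegative terms of the defect vanish one
    by one.\<close>
  have on_S: "(\<Sum>j<m. Q $$ (k, j)) = 1 \<and> (\<forall>j<m. Q $$ (k, j) * (M - w j) = 0)"
    if "k \<in> S" for k
  proof -
    have k: "k < m" "w k = M" using that by (auto simp: S_def)
    have terms: "0 \<le> Q $$ (k, j) * (M - w j)" if "j < m" for j
      using nonneg[OF k(1) that] le_M[OF that] by simp
    have defect: "(\<Sum>j<m. Q $$ (k, j) * (M - w j)) =
        M * (\<Sum>j<m. Q $$ (k, j)) - (\<Sum>j<m. Q $$ (k, j) * w j)"
      by (simp add: algebra_simps sum_subtractf sum_distrib_left)
    have "M * (\<Sum>j<m. Q $$ (k, j)) \<le> M * 1"
      using M row_le[OF k(1)] by (intro mult_left_mono) auto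
    moreover have "0 \<le> (\<Sum>j<m. Q $$ (k, j) * (M - w j))"
      using terms by (intro sum_nonneg) auto
    ultimately have "M * (\<Sum>j<m. Q $$ (k, j)) = M * 1"
      and "(\<Sum>j<m. Q $$ (k, j) * (M - w j)) = 0"
      using w[OF k(1)] k(2) defect by linarith+
    then show ?thesis
      using M terms by (subst (asm) sum_nonneg_eq_0_iff) auto
  qed
  have "S \<noteq> {..<m}" using row_less on_S by force
  then have "S \<subset> {..<m}" by (auto simp: S_def)
  then obtain k j where "k \<in> S" "j < m" "j \<notin> S" "Q $$ (k, j) \<noteq> 0"
    using irreducible_mat_exists_nonzero[OF irreducible Q] \<open>S \<noteq> {}\<close> by metis
  \<comment> \<open>Since \<open>j\<close> is outside \<open>S\<close>, \<open>M - w j\<close> is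
    nonzero, so \<open>on_S\<close> forces \<open>Q $$ (k, j) = 0\<close>.\<close>
  then show False using on_S[of k] by (auto simp: S_def)
qed

text \<open>The maximum principle applies to \<open>w\<close> and to its negative, bounding
  \<open>w\<close> from both sides.\<close>

lemma fixed_point_eq_0:
  assumes "\<And>i. i < m \<Longrightarrow> w i = (\<Sum>j<m. Q $$ (i, j) * w j)" "i < m"
  shows "w i = 0"
proof -
  have "w i \<le> 0" using assms by (intro maximum_principle) auto
  moreover have "- w i \<le> 0"
    using assms by (intro maximum_principle[of "\<lambda>i. - w i"]) (auto simp: sum_negf)
  ultimately show ?thesis by simp
qed

text \<open>A one-column matrix rather than a vector, so that it can be compared with
  \<open>r\<close> and serve as a block.\<close>

definition ones :: "real mat" where
  "ones = mat m 1 (\<lambda>_. 1)"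

lemma ones_carrier: "ones \<in> carrier_mat m 1"
  by (simp add: ones_def)

lemma index_pow_mult_ones:
  assumes "i < m"
  shows "(Q ^\<^sub>m n * ones) $$ (i, 0) = (\<Sum>j<m. (Q ^\<^sub>m n) $$ (i, j))"
  using index_mult_mat_sum[OF pow_carrier_mat[OF Q] ones_carrier assms, of 0]
  by (simp add: ones_def)

lemma pow_mult_ones_Suc: "Q ^\<^sub>m Suc n * ones = Q * (Q ^\<^sub>m n * ones)"
  unfolding pow_mat_Suc_left[OF Q] by (rule assoc_mult_mat[OF Q pow_carrier_mat[OF Q] ones_carrier])

lemma pow_mult_ones_nonneg: "i < m \<Longrightarrow> 0 \<le> (Q ^\<^sub>m n * ones) $$ (i, 0)"
  by (simp only: index_pow_mult_ones) (auto intro!: sum_nonneg pow_mat_nonneg[OF Q nonneg])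

text \<open>Entrywise \<open>Q * ones\<close> is at most \<open>ones\<close>, and multiplication by
  the nonnegative \<open>Q ^\<^sub>m n\<close> preserves this.\<close>

lemma pow_mult_ones_decseq:
  assumes i: "i < m"
  shows "decseq (\<lambda>n. (Q ^\<^sub>m n * ones) $$ (i, 0))"
proof (rule decseq_SucI)
  fix n
  have "Q ^\<^sub>m Suc n * ones = Q ^\<^sub>m n * (Q * ones)"
    unfolding pow_mat.simps by (rule assoc_mult_mat[OF pow_carrier_mat[OF Q] Q ones_carrier])
  then have "(Q ^\<^sub>m Suc n * ones) $$ (i, 0) = (\<Sum>j<m. (Q ^\<^sub>m n) $$ (i, j) * (Q * ones) $$ (j, 0))"
    using index_mult_mat_sum[OF pow_carrier_mat[OF Q] mult_carrier_mat[OF Q ones_carrier] i, of 0]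
    by simp
  also have "\<dots> \<le> (\<Sum>j<m. (Q ^\<^sub>m n) $$ (i, j) * 1)"
  proof (intro sum_mono mult_left_mono)
    fix j assume "j \<in> {..<m}"
    then show "(Q * ones) $$ (j, 0) \<le> 1" "0 \<le> (Q ^\<^sub>m n) $$ (i, j)"
      using row_le index_pow_mult_ones[of j 1] pow_mat_nonneg[OF Q nonneg] i Q by auto
  qed
  finally show "(Q ^\<^sub>m Suc n * ones) $$ (i, 0) \<le> (Q ^\<^sub>m n * ones) $$ (i, 0)"
    by (simp only: index_pow_mult_ones[OF i] mult_1_right)
qed

lemma pow_mult_ones_tendsto_0:
  assumes "i < m"
  shows "(\<lambda>n. (Q ^\<^sub>m n * ones) $$ (i, 0)) \<longlonglongrightarrow> 0"
proof -
  let ?u = "\<lambda>i n. (Q ^\<^sub>m n * ones) $$ (i, 0)"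
  have "\<exists>s. ?u i \<longlonglongrightarrow> s" if "i < m" for i
    using decseq_convergent[OF pow_mult_ones_decseq[OF that], of 0] pow_mult_ones_nonneg[OF that]
    by metis
  then obtain s where s: "\<And>i. i < m \<Longrightarrow> ?u i \<longlonglongrightarrow> s i" by metis
  \<comment> \<open>The shifted sequence has two descriptions of its limit: \<open>s i\<close> as a
    tail, and the \<open>Q\<close>-weighted sum of \<open>s\<close> by the left recursion.\<close>
  have "s i = (\<Sum>j<m. Q $$ (i, j) * s j)" if i: "i < m" for i
  proof (rule LIMSEQ_unique)
    show "(\<lambda>n. ?u i (Suc n)) \<longlonglongrightarrow> s i" by (rule LIMSEQ_Suc[OF s[OF i]])
    have "?u i (Suc n) = (\<Sum>j<m. Q $$ (i, j) * ?u j n)" for n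
      unfolding pow_mult_ones_Suc
      by (rule index_mult_mat_sum[OF Q mult_carrier_mat[OF pow_carrier_mat[OF Q] ones_carrier] i])
        simp
    then show "(\<lambda>n. ?u i (Suc n)) \<longlonglongrightarrow> (\<Sum>j<m. Q $$ (i, j) * s j)"
      using s by (auto intro!: tendsto_intros)
  qed
  then have "s i = 0" using assms by (rule fixed_point_eq_0)
  then show ?thesis using s[OF assms] by simp
qed

text \<open>An entry of a nonnegative matrix lies between 0 and its row sum.\<close>

lemma pow_tendsto_0:
  assumes "i < m" "j < m"
  shows "(\<lambda>n. (Q ^\<^sub>m n) $$ (i, j)) \<longlonglongrightarrow> 0"
proof (rule tendsto_sandwich[OF _ _ tendsto_const pow_mult_ones_tendsto_0[OF assms(1)]])
  have nn: "0 \<le> (Q ^\<^sub>m n) $$ (i, k)" if "k < m" for n k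
    using pow_mat_nonneg[OF Q nonneg] assms that by blast
  show "\<forall>\<^sub>F n in sequentially. 0 \<le> (Q ^\<^sub>m n) $$ (i, j)"
    using nn assms by simp
  show "\<forall>\<^sub>F n in sequentially. (Q ^\<^sub>m n) $$ (i, j) \<le> (Q ^\<^sub>m n * ones) $$ (i, 0)"
    unfolding index_pow_mult_ones[OF assms(1)]
    using nn assms by (intro always_eventually allI member_le_sum) auto
qed

text \<open>A kernel vector of \<open>1\<^sub>m m - Q\<close> is a fixed vector of \<open>Q\<close>,
  hence zero.\<close>

lemma one_minus_inverse_exists:
  obtains N where "N \<in> carrier_mat m m" "(1\<^sub>m m - Q) * N = 1\<^sub>m m" "N * (1\<^sub>m m - Q) = 1\<^sub>m m"
proof (rule inverse_mat_exists)
  show "1\<^sub>m m - Q \<in> carrier_mat m m" by (rule minus_carrier_mat[OF Q])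
  fix v assume v: "v \<in> carrier_vec m" and "(1\<^sub>m m - Q) *\<^sub>v v = 0\<^sub>v m"
  then have fixed: "v - Q *\<^sub>v v = 0\<^sub>v m"
    using Q by (simp add: minus_mult_distrib_mat_vec[of _ m m])
  have "v $ i = (\<Sum>j<m. Q $$ (i, j) * v $ j)" if "i < m" for i
    using arg_cong[OF fixed, of "\<lambda>x. x $ i"] that Q v
    by (simp add: scalar_prod_def atLeast0LessThan)
  then have "v $ i = 0" if "i < m" for i
    using that by (rule fixed_point_eq_0)
  then show "v = 0\<^sub>v m" using v by (intro eq_vecI) auto
qed

text \<open>The lower left block of the power is a geometric sum in \<open>Q\<close> applied to
  \<open>ones - Q * ones\<close>, so it telescopes.\<close>

lemma pow_absorbing_block:
  assumes T: "T = four_block_mat (1\<^sub>m 1) (0\<^sub>m 1 m) (ones - Q * ones) Q"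
  shows "T ^\<^sub>m n = four_block_mat (1\<^sub>m 1) (0\<^sub>m 1 m) (ones - Q ^\<^sub>m n * ones) (Q ^\<^sub>m n)"
proof (induction n)
  case 0
  show ?case
    using Q by (intro eq_matI) (auto simp: T ones_def)
next
  case (Suc n)
  note Qn = pow_carrier_mat[OF Q, of n]
  have c: "ones - Q ^\<^sub>m k * ones \<in> carrier_mat m 1" for k
    by (rule minus_carrier_mat[OF mult_carrier_mat[OF pow_carrier_mat[OF Q] ones_carrier]])
  have c1: "ones - Q * ones \<in> carrier_mat m 1"
    by (rule minus_carrier_mat[OF mult_carrier_mat[OF Q ones_carrier]])
  \<comment> \<open>This product enters the lower left block of \<open>T ^\<^sub>m n * T\<close>;
    the terms \<open>Q ^\<^sub>m n * ones\<close> cancel there.\<close>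
  have "Q ^\<^sub>m n * (ones - Q * ones) = Q ^\<^sub>m n * ones - Q ^\<^sub>m n * (Q * ones)"
    by (rule mult_minus_distrib_mat[OF Qn ones_carrier mult_carrier_mat[OF Q ones_carrier]])
  also have "Q ^\<^sub>m n * (Q * ones) = Q ^\<^sub>m Suc n * ones"
    using assoc_mult_mat[OF Qn Q ones_carrier] by simp
  finally have "(ones - Q ^\<^sub>m n * ones) + Q ^\<^sub>m n * (ones - Q * ones)
      = ones - Q ^\<^sub>m Suc n * ones"
    using Q Qn by (intro eq_matI) (auto simp: ones_def)
  moreover have "T ^\<^sub>m Suc n = four_block_mat (1\<^sub>m 1) (0\<^sub>m 1 m)
      ((ones - Q ^\<^sub>m n * ones) + Q ^\<^sub>m n * (ones - Q * ones)) (Q ^\<^sub>m Suc n)"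
    unfolding pow_mat.simps Suc unfolding T
    by (subst mult_four_block_mat[OF one_carrier_mat zero_carrier_mat c Qn
          one_carrier_mat zero_carrier_mat c1 Q])
      (simp only: left_mult_one_mat[OF one_carrier_mat] left_mult_one_mat[OF zero_carrier_mat]
        left_mult_zero_mat[OF c1] left_mult_zero_mat[OF Q] right_mult_one_mat[OF c]
        right_mult_zero_mat[OF c] right_add_zero_mat[OF one_carrier_mat]
        right_add_zero_mat[OF zero_carrier_mat] left_add_zero_mat[OF mult_carrier_mat[OF Qn Q]])
  ultimately show ?case by simp
qed

end

section \<open>The trust matrix with a stubborn agent: blocks and limit\<close>

theorem proposition1:
  fixes K :: nat and T r Q :: "real mat"
  assumes "K \<ge> 2"
    and "T \<in> carrier_mat K K"
    and "stochastic_mat T"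
    and "r \<in> carrier_mat (K - 1) 1"
    and "Q \<in> carrier_mat (K - 1) (K - 1)"
    and "T = four_block_mat (1\<^sub>m 1) (0\<^sub>m 1 (K - 1)) r Q"
    and "irreducible_mat Q"
    and "\<exists>i. 0 < i \<and> i < K \<and> T $$ (i, 0) > 0"
  shows "\<exists>N \<in> carrier_mat (K - 1) (K - 1).
           inverts_mat (1\<^sub>m (K - 1) - Q) N \<and> inverts_mat N (1\<^sub>m (K - 1) - Q) \<and>
           mat_LIMSEQ (\<lambda>n. T ^\<^sub>m n)
             (four_block_mat (1\<^sub>m 1) (0\<^sub>m 1 (K - 1)) (N * r) (0\<^sub>m (K - 1) (K - 1)))"
proof -
  define m where "m = K - 1"
  have K: "K = Suc m" using assms(1) by (simp add: m_def)
  note r = assms(4)[folded m_def] and Q = assms(5)[folded m_def] and T = assms(6)[folded m_def]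
  \<comment> \<open>Index 0 is the stubborn agent, so ordinary agent \<open>i\<close> of
    \<open>r\<close> and \<open>Q\<close> sits at \<open>Suc i\<close> in \<open>T\<close>.\<close>
  have T_r: "T $$ (Suc i, 0) = r $$ (i, 0)" if "i < m" for i
    using that r Q by (simp add: T)
  have T_Q: "T $$ (Suc i, Suc j) = Q $$ (i, j)" if "i < m" "j < m" for i j
    using that r Q by (simp add: T)
  have T_nonneg: "0 \<le> T $$ (i, j)" if "i < K" "j < K" for i j
    using assms(2,3) that by (auto simp: stochastic_mat_def)
  have "(\<Sum>j<K. T $$ (Suc i, j)) = 1" if "i < m" for i
    using assms(2,3) that by (auto simp: stochastic_mat_def K)
  then have row: "r $$ (i, 0) + (\<Sum>j<m. Q $$ (i, j)) = 1" if "i < m" for i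
    using that by (simp add: K sum.lessThan_Suc_shift T_r T_Q del: sum.lessThan_Suc)
  have r_nonneg: "0 \<le> r $$ (i, 0)" if "i < m" for i
    using T_nonneg[of "Suc i" 0] that by (simp add: T_r K)
  obtain i0 where i0: "i0 < m" "0 < r $$ (i0, 0)"
    using assms(8) T_r unfolding K by (metis Suc_less_eq gr0_implies_Suc)
  \<comment> \<open>Row \<open>i\<close> of \<open>Q\<close> sums to 1 minus the entry of
    \<open>r\<close>: at most 1, and less than 1 in row \<open>i0\<close>.\<close>
  interpret irreducible_substochastic Q m
  proof
    show "0 \<le> Q $$ (i, j)" if "i < m" "j < m" for i j
      using T_nonneg[of "Suc i" "Suc j"] that by (simp add: T_Q K)
    show "(\<Sum>j<m. Q $$ (i, j)) \<le> 1" if "i < m" for i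
      using row[OF that] r_nonneg[OF that] by simp
    show "\<exists>i<m. (\<Sum>j<m. Q $$ (i, j)) < 1"
      using row[OF i0(1)] i0 by (intro exI[of _ i0]) simp
  qed (fact Q assms(7))+
  \<comment> \<open>The unit row sums of \<open>T\<close>, read as a matrix identity, give the
    telescoping form of \<open>r\<close>.\<close>
  have r_eq: "r = ones - Q * ones"
  proof (rule eq_matI)
    fix i j assume "i < dim_row (ones - Q * ones)" "j < dim_col (ones - Q * ones)"
    then have ij: "i < m" "j = 0" using Q ones_carrier by auto
    have "(Q * ones) $$ (i, 0) = (\<Sum>j<m. Q $$ (i, j))"
      using index_pow_mult_ones[OF ij(1), of 1] Q by simp
    then show "r $$ (i, j) = (ones - Q * ones) $$ (i, j)"
      using row[OF ij(1)] ij Q by (simp add: ones_def)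
  qed (use r Q ones_carrier in auto)
  obtain N where N: "N \<in> carrier_mat m m" "(1\<^sub>m m - Q) * N = 1\<^sub>m m" "N * (1\<^sub>m m - Q) = 1\<^sub>m m"
    by (rule one_minus_inverse_exists)
  have "(1\<^sub>m m - Q) * ones = r"
    unfolding r_eq by (subst minus_mult_distrib_mat[OF one_carrier_mat Q ones_carrier])
      (simp add: left_mult_one_mat[OF ones_carrier])
  then have Nr: "N * r = ones"
    using assoc_mult_mat[OF N(1) minus_carrier_mat[OF Q] ones_carrier, of "1\<^sub>m m"] N(3)
    by (simp add: left_mult_one_mat[OF ones_carrier])
  note Tn = pow_absorbing_block[OF T[unfolded r_eq]]
  let ?L = "four_block_mat (1\<^sub>m 1) (0\<^sub>m 1 m) (N * r) (0\<^sub>m m m)"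
  have "mat_LIMSEQ (\<lambda>n. T ^\<^sub>m n) ?L"
    unfolding mat_LIMSEQ_def
  proof (intro conjI allI impI)
    fix n show "T ^\<^sub>m n \<in> carrier_mat (dim_row ?L) (dim_col ?L)"
      using assms(2) by (simp add: K)
  next
    fix i j assume "i < dim_row ?L" "j < dim_col ?L"
    then have ij: "i < Suc m" "j < Suc m" by auto
    show "(\<lambda>n. (T ^\<^sub>m n) $$ (i, j)) \<longlonglongrightarrow> ?L $$ (i, j)"
    \<comment> \<open>The top row of \<open>T ^\<^sub>m n\<close> is constant in \<open>n\<close>.
      Below it, the first column is 1 minus vanishing row sums, and the remaining entries are those
      of \<open>Q ^\<^sub>m n\<close>.\<close>
    proof (cases i)
      case 0
      then show ?thesis using ij Q by (simp add: Tn)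
    next
      case (Suc i')
      then have i': "i' < m" using ij by simp
      show ?thesis
      proof (cases j)
        case 0
        have "(\<lambda>n. 1 - (Q ^\<^sub>m n * ones) $$ (i', 0)) \<longlonglongrightarrow> 1 - 0"
          by (intro tendsto_intros pow_mult_ones_tendsto_0 i')
        then show ?thesis
          using Q i' 0 Suc by (simp add: Tn Nr ones_def)
      next
        case (Suc j')
        then show ?thesis
          using pow_tendsto_0[OF i', of j'] ij i' Q \<open>i = Suc i'\<close> by (simp add: Tn)
      qed
    qed
  qed
  then show ?thesis
    using N Q unfolding m_def[symmetric] by (auto simp: inverts_mat_def)
qed

end
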